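(* Algorithm MOMENTI (described in the context), run on a $D$-dimensional time series of length $n$ with parameters $K$ and $L$, has space complexity $O(K\cdot L\cdot D\cdot n)$.
   Context: A $D$-dimensional time series is $\mathbf{T}=(T^{(1)},\dots,T^{(D)})$, $T^{(f)}\in\mathbb{R}^n$; for window $w$, the subsequences are $\mathbf{T}_a=(T^{(1)}_a,\dots,T^{(D)}_a)$, $a\in[n-w+1]$, $T^{(f)}_a=(T^{(f)}(a),\dots,T^{(f)}(a+w-1))$. A basic hash is $h(x)=\lfloor(a\cdot x+b)/r\rfloor$ ($a$ i.i.d. Gaussian, $b$ uniform in $[0,r]$). Algorithm MOMENTI (inputs $\mathbf{T},w,k,K,L,d,\delta$) stores, for each $f\in[D]$ and $j\in[L]$, the composite hashes $h^f_{K,j}(T^{(f)}_a)$ (strings of $K$ basic hash values) of all subsequences, sorted lexicographically; it keeps a priority queue of at most $k$ candidate pairs; it then iterates over prefix lengths $i=K,\dots,1$ and repetitions $j=1,\dots,L$, for each pair of subsequences counting $W(a,b)$, the number of dimensions whose length-$i$ prefixes collide, computing $\operatorname{dist}_d$ for pairs with $W(a,b)\ge d$ (processed on the fly while scanning, without storing all weights), updating the queue, and stopping when a probabilistic stopping condition holds (otherwise returning the exact answer).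
   Formalization: The bound is proved for queue size k = O(K·L·D·n) (e.g. constant k), since a queue of about n²/2 pairs would violate it; space is counted in machine words, and evaluating the unspecified stopping condition is charged O(1) words. *)

theory Defs
  imports "HOL-Probability.Probability" "HOL-Library.List_Lexorder"
begin

text \<open>
  MOMENTI is modelled as a machine that is deterministic once the hash functions have been drawn.
  Everything it keeps between two steps is a field of the record \<open>memory\<close>, and space is counted
  in words: a natural number, an integer (hash value) or a real occupies one word. A single step
  only does work that needs a bounded number of further words (one pass over stored lists
  with an accumulator, or an insertion into a stored list); these are part of \<open>register_words\<close>.

  Indices are zero-based: dimensions \<open>f < D\<close>, repetitions \<open>j < L\<close>, positions \<open>t < K\<close> in a hash
  string, subsequences \<open>a < n - w + 1\<close>.
\<close>

datatype phase = Draw | Hash | Scan | Weigh | Dist | Stop_Test | Exact | Halt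

record memory =
  phase :: phase
  series :: "real list list"
  hash_funs :: "(real list \<times> real) list"
  tables :: "(int list \<times> nat) list list"
  queue :: "(real \<times> nat \<times> nat) list"
  hash_buf :: "int list"
  dist_buf :: "real list"
  rf :: nat
  rg :: nat
  rj :: nat
  rt :: nat
  ri :: nat
  rp :: nat
  rq :: nat
  ra :: nat
  rb :: nat
  rW :: nat

definition list_words :: "('a \<Rightarrow> nat) \<Rightarrow> 'a list \<Rightarrow> nat" where
  "list_words size_of xs = 1 + (\<Sum>x\<leftarrow>xs. size_of x)"

text \<open>
  The phase, the ten registers, the parameters \<open>n, D, w, K, L, k, d, \<delta>, r\<close> and scratch
  for a single step.
\<close>
definition register_words :: nat where
  "register_words = 32"

definition memory_words :: "memory \<Rightarrow> nat" where
  "memory_words m =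
     list_words (list_words (\<lambda>_. 1)) (series m)
   + list_words (\<lambda>(v, b). list_words (\<lambda>_. 1) v + 1) (hash_funs m)
   + list_words (list_words (\<lambda>(s, a). list_words (\<lambda>_. 1) s + 1)) (tables m)
   + list_words (\<lambda>_. 3) (queue m)
   + list_words (\<lambda>_. 1) (hash_buf m)
   + list_words (\<lambda>_. 1) (dist_buf m)
   + register_words"

definition dot :: "real list \<Rightarrow> real list \<Rightarrow> real" where
  "dot x y = (\<Sum>(u, v)\<leftarrow>zip x y. u * v)"

definition euclid :: "real list \<Rightarrow> real list \<Rightarrow> real" where
  "euclid x y = sqrt (\<Sum>(u, v)\<leftarrow>zip x y. (u - v)\<^sup>2)"

definition basic_hash :: "real \<Rightarrow> real list \<times> real \<Rightarrow> real list \<Rightarrow> int" where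
  "basic_hash r h x = \<lfloor>(dot (fst h) x + snd h) / r\<rfloor>"

definition hash_string :: "(int list \<times> nat) list \<Rightarrow> nat \<Rightarrow> int list" where
  "hash_string tab a = fst (the (find (\<lambda>e. snd e = a) tab))"

text \<open>The queue is sorted by distance, holds no pair twice, and keeps the \<open>k\<close> closest pairs.\<close>
definition queue_insert ::
  "nat \<Rightarrow> real \<times> nat \<times> nat \<Rightarrow> (real \<times> nat \<times> nat) list \<Rightarrow> (real \<times> nat \<times> nat) list" where
  "queue_insert k e Q = (if snd e \<in> snd ` set Q then Q else take k (insort_key fst e Q))"

text \<open>
  The parameter \<open>stop \<delta> i j Q\<close> is the stopping condition, tested with prefix length \<open>i\<close>,
  repetition \<open>j\<close> and queue content \<open>Q\<close>. It is arbitrary.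
\<close>
locale momenti =
  fixes n D w K L k d :: nat
    and \<delta> r :: real
    and T :: "real list list"
    and stop :: "real \<Rightarrow> nat \<Rightarrow> nat \<Rightarrow> (real \<times> nat \<times> nat) list \<Rightarrow> bool"
  assumes dims: "length T = D" "\<forall>x\<in>set T. length x = n" "1 \<le> D"
    and window: "1 \<le> w" "w \<le> n"
    and pars: "1 \<le> K" "1 \<le> L" "1 \<le> k" "1 \<le> d" "d \<le> D"
    and reals: "0 < \<delta>" "\<delta> < 1" "0 < r"
begin

text \<open>
  The random choices: for every dimension, repetition and position in the string one basic hash,
  with i.i.d. standard Gaussian coefficients and a uniform offset, all independent.
\<close>
definition hash_measure ::
  "((nat \<times> nat \<times> nat \<times> nat \<Rightarrow> real) \<times> (nat \<times> nat \<times> nat \<Rightarrow> real)) measure" where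
  "hash_measure =
     (\<Pi>\<^sub>M _\<in>{..<D} \<times> {..<L} \<times> {..<K} \<times> {..<w}. density lborel std_normal_density)
     \<Otimes>\<^sub>M (\<Pi>\<^sub>M _\<in>{..<D} \<times> {..<L} \<times> {..<K}. uniform_measure lborel {0..r})"

definition num_subseqs :: nat where
  "num_subseqs = n - w + 1"

definition subsequence :: "memory \<Rightarrow> nat \<Rightarrow> nat \<Rightarrow> real list" where
  "subsequence m f a = take w (drop a (series m ! f))"

definition table :: "memory \<Rightarrow> nat \<Rightarrow> nat \<Rightarrow> (int list \<times> nat) list" where
  "table m f j = tables m ! (f * L + j)"

definition collide :: "memory \<Rightarrow> nat \<Rightarrow> nat \<Rightarrow> nat \<Rightarrow> nat \<Rightarrow> nat \<Rightarrow> bool" where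
  "collide m i f j a b \<longleftrightarrow>
     take i (hash_string (table m f j) a) = take i (hash_string (table m f j) b)"

definition initial :: memory where
  "initial = \<lparr>phase = Draw, series = T, hash_funs = [], tables = replicate (D * L) [],
     queue = [], hash_buf = [], dist_buf = [],
     rf = 0, rg = 0, rj = 0, rt = 0, ri = 0, rp = 0, rq = 0, ra = 0, rb = 0, rW = 0\<rparr>"

text \<open>
  \<^item> \<open>Draw\<close> stores the hash functions; \<open>Hash\<close> builds the tables, sorted lexicographically
    by hash string, by insertion.
  \<^item> \<open>Scan\<close> runs through \<open>i = K, \<dots>, 1\<close> and all \<open>j\<close>. For each dimension \<open>f\<close> it
    visits the pairs of table positions \<open>p < q\<close> whose strings share the prefix of length \<open>i\<close>;
    by sortedness these \<open>q\<close> directly follow \<open>p\<close>. Pairs that collide in no dimension have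
    \<open>W = 0 < d\<close> and are not visited.
  \<^item> \<open>Weigh\<close> computes \<open>W(a, b)\<close> for the current pair in one register, so no
    weight outlives the visit of its pair.
  \<^item> \<open>Dist\<close> computes \<open>dist\<^sub>d\<close>, the sum of the \<open>d\<close> smallest of the \<open>D\<close> per-dimension
    distances, and updates the queue. \<open>Stop_Test\<close> ends each repetition.
  \<^item> If the condition never held, \<open>Exact\<close> computes \<open>dist\<^sub>d\<close> for all pairs (with \<open>ri = 0\<close>, which
    tells \<open>Dist\<close> where to return).
\<close>
definition step ::
  "(nat \<times> nat \<times> nat \<times> nat \<Rightarrow> real) \<times> (nat \<times> nat \<times> nat \<Rightarrow> real) \<Rightarrow> memory \<Rightarrow> memory" where
  "step \<omega> m = (case phase m of
     Draw \<Rightarrow>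
       if rf m = D then m\<lparr>phase := Hash, rf := 0, rj := 0, ra := 0, rt := 0\<rparr>
       else if rj m = L then m\<lparr>rf := rf m + 1, rj := 0\<rparr>
       else if rt m = K then m\<lparr>rj := rj m + 1, rt := 0\<rparr>
       else m\<lparr>hash_funs := hash_funs m @
                [(map (\<lambda>s. fst \<omega> (rf m, rj m, rt m, s)) [0..<w], snd \<omega> (rf m, rj m, rt m))],
              rt := rt m + 1\<rparr>
   | Hash \<Rightarrow>
       if rf m = D then m\<lparr>phase := Scan, ri := K, rj := 0, rf := 0, rp := 0, rq := 1\<rparr>
       else if rj m = L then m\<lparr>rf := rf m + 1, rj := 0\<rparr>
       else if ra m = num_subseqs then m\<lparr>rj := rj m + 1, ra := 0\<rparr>
       else if rt m = K then
         m\<lparr>tables := (tables m)[rf m * L + rj m :=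
              insort_key fst (hash_buf m, ra m) (table m (rf m) (rj m))],
           hash_buf := [], ra := ra m + 1, rt := 0\<rparr>
       else
         m\<lparr>hash_buf := hash_buf m @
              [basic_hash r (hash_funs m ! ((rf m * L + rj m) * K + rt m))
                 (subsequence m (rf m) (ra m))],
           rt := rt m + 1\<rparr>
   | Scan \<Rightarrow>
       if ri m = 0 then m\<lparr>phase := Exact, ra := 0, rb := 1\<rparr>
       else if rj m = L then m\<lparr>ri := ri m - 1, rj := 0\<rparr>
       else if rf m = D then m\<lparr>phase := Stop_Test\<rparr>
       else if rp m = num_subseqs then m\<lparr>rf := rf m + 1, rp := 0, rq := 1\<rparr>
       else let tab = table m (rf m) (rj m) in
         if rq m < num_subseqs \<and>
            take (ri m) (fst (tab ! rp m)) = take (ri m) (fst (tab ! rq m))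
         then m\<lparr>phase := Weigh,
                ra := min (snd (tab ! rp m)) (snd (tab ! rq m)),
                rb := max (snd (tab ! rp m)) (snd (tab ! rq m)),
                rg := 0, rW := 0\<rparr>
         else m\<lparr>rp := rp m + 1, rq := rp m + 2\<rparr>
   | Weigh \<Rightarrow>
       if rg m < D then
         m\<lparr>rW := (if collide m (ri m) (rg m) (rj m) (ra m) (rb m) then rW m + 1 else rW m),
           rg := rg m + 1\<rparr>
       else if d \<le> rW m then m\<lparr>phase := Dist, rg := 0\<rparr>
       else m\<lparr>phase := Scan, rq := rq m + 1\<rparr>
   | Dist \<Rightarrow>
       if rg m < D then
         m\<lparr>dist_buf := insort (euclid (subsequence m (rg m) (ra m)) (subsequence m (rg m) (rb m)))
              (dist_buf m),
           rg := rg m + 1\<rparr>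
       else
         let m' = m\<lparr>queue := queue_insert k (sum_list (take d (dist_buf m)), ra m, rb m) (queue m),
                    dist_buf := []\<rparr>
         in if ri m = 0 then m'\<lparr>phase := Exact, rb := rb m + 1\<rparr>
            else m'\<lparr>phase := Scan, rq := rq m + 1\<rparr>
   | Stop_Test \<Rightarrow>
       if stop \<delta> (ri m) (rj m) (queue m) then m\<lparr>phase := Halt\<rparr>
       else m\<lparr>phase := Scan, rj := rj m + 1, rf := 0, rp := 0, rq := 1\<rparr>
   | Exact \<Rightarrow>
       if ra m = num_subseqs then m\<lparr>phase := Halt\<rparr>
       else if rb m < num_subseqs then m\<lparr>phase := Dist, rg := 0\<rparr>
       else m\<lparr>ra := ra m + 1, rb := ra m + 2\<rparr>
   | Halt \<Rightarrow> m)"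

text \<open>
  The largest number of words in use at any time of the run with random choices \<open>\<omega>\<close>.
  It includes the queue, which can hold \<open>k\<close> pairs and hence up to about \<open>n\<^sup>2 / 2\<close> of them: a bound
  \<open>O(K * L * D * n)\<close> presupposes that \<open>k\<close> is a constant, or at least \<open>k = O(K * L * D * n)\<close>.
\<close>
definition run_space ::
  "(nat \<times> nat \<times> nat \<times> nat \<Rightarrow> real) \<times> (nat \<times> nat \<times> nat \<Rightarrow> real) \<Rightarrow> enat" where
  "run_space \<omega> = (SUP s. enat (memory_words ((step \<omega> ^^ s) initial)))"

end

end

theory Submission
  imports Defs
begin

text \<open>
  The space is dominated by the hash functions (\<open>K L D\<close> of them, \<open>w + 2\<close> words each) and the tables
  (\<open>L D\<close> of them, with \<open>n - w + 1\<close> entries of \<open>K + 2\<close> words each). The loop counters determine how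
  many of these have been stored at any moment, so an invariant that ties the word counts to the
  counters bounds them; pairs and weights are never stored, apart from the queue of length \<open>k\<close>.
\<close>

section \<open>Word counts of lists\<close>

lemma list_words_Nil [simp]: "list_words g [] = 1"
  by (simp add: list_words_def)

lemma list_words_const: "list_words (\<lambda>_. c) xs = 1 + c * length xs"
  by (simp add: list_words_def sum_list_triv)

lemma list_words_replicate: "list_words g (replicate N x) = 1 + N * g x"
  by (simp add: list_words_def sum_list_replicate)

lemma list_words_uniform:
  assumes "\<And>x. x \<in> set xs \<Longrightarrow> g x = c"
  shows "list_words g xs = 1 + c * length xs"
proof -
  have "map g xs = map (\<lambda>_. c) xs"
    using assms by simp
  then have "(\<Sum>x\<leftarrow>xs. g x) = (\<Sum>x\<leftarrow>xs. c)"
    by (rule arg_cong)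
  also have "\<dots> = c * length xs"
    by (simp add: sum_list_triv)
  finally show ?thesis
    unfolding list_words_def by (rule arg_cong)
qed

lemma list_words_insort_key: "list_words g (insort_key h x xs) = g x + list_words g xs"
  by (induction xs) (simp_all add: list_words_def)

text \<open>The replaced entry is moved to the left-hand side to avoid truncated subtraction on
  naturals.\<close>

lemma list_words_update:
  assumes "i < length xs"
  shows "list_words g (xs[i := x]) + g (xs ! i) = list_words g xs + g x"
  using assms
proof (induction xs arbitrary: i)
  case (Cons y ys)
  show ?case
  proof (cases i)
    case (Suc i')
    then show ?thesis
      using Cons.IH[of i'] Cons.prems by (simp add: list_words_def)
  qed (simp add: list_words_def)
qed simp

lemma length_queue_insert:
  "length Q \<le> k \<Longrightarrow> length (queue_insert k e Q) \<le> k"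
  by (simp add: queue_insert_def)

abbreviation hash_fun_words :: "(real list \<times> real) list \<Rightarrow> nat" where
  "hash_fun_words \<equiv> list_words (\<lambda>(v, b). list_words (\<lambda>_. 1) v + 1)"

abbreviation entry_words :: "int list \<times> nat \<Rightarrow> nat" where
  "entry_words \<equiv> \<lambda>(s, a). list_words (\<lambda>_. 1) s + 1"

abbreviation tables_words :: "(int list \<times> nat) list list \<Rightarrow> nat" where
  "tables_words \<equiv> list_words (list_words entry_words)"

section \<open>Invariants of the phases\<close>

context momenti
begin

text \<open>The counters are digits of a mixed-radix number, here the number of functions drawn so
  far. A digit may sit at its limit while the carry is pending; the implications then force the
  lower digits to be 0, so the number never exceeds \<open>D * L * K\<close>.\<close>

definition draw_inv :: "memory \<Rightarrow> bool" where
  "draw_inv m \<longleftrightarrow>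
     rf m \<le> D \<and> rj m \<le> L \<and> rt m \<le> K \<and>
     (rf m = D \<longrightarrow> rj m = 0) \<and> (rf m = D \<or> rj m = L \<longrightarrow> rt m = 0) \<and>
     hash_fun_words (hash_funs m) = 1 + (w + 2) * ((rf m * L + rj m) * K + rt m) \<and>
     length (tables m) = D * L \<and> tables_words (tables m) = 1 + D * L \<and>
     hash_buf m = [] \<and> dist_buf m = []"

text \<open>Now \<open>ra\<close> is the lowest digit of the count, because an entry reaches a table
  only when its string is complete; \<open>rt\<close> counts the hash values waiting in the
  buffer.\<close>

definition hash_inv :: "memory \<Rightarrow> bool" where
  "hash_inv m \<longleftrightarrow>
     rf m \<le> D \<and> rj m \<le> L \<and> ra m \<le> num_subseqs \<and> rt m \<le> K \<and>
     (rf m = D \<longrightarrow> rj m = 0) \<and> (rf m = D \<or> rj m = L \<longrightarrow> ra m = 0) \<and>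
     (rf m = D \<or> rj m = L \<or> ra m = num_subseqs \<longrightarrow> rt m = 0) \<and>
     hash_fun_words (hash_funs m) \<le> 1 + (w + 2) * (D * L * K) \<and>
     length (tables m) = D * L \<and>
     tables_words (tables m) = 1 + D * L + (K + 2) * ((rf m * L + rj m) * num_subseqs + ra m) \<and>
     length (hash_buf m) = rt m \<and> dist_buf m = []"

text \<open>Hash functions and tables no longer change, so upper bounds suffice and one invariant
  serves all later phases. \<open>Weigh\<close> uses \<open>rg\<close> too, hence its link to
  \<open>dist_buf\<close> only in \<open>Dist\<close>.\<close>

definition search_inv :: "memory \<Rightarrow> bool" where
  "search_inv m \<longleftrightarrow>
     hash_fun_words (hash_funs m) \<le> 1 + (w + 2) * (D * L * K) \<and>
     tables_words (tables m) \<le> 1 + D * L + (K + 2) * (D * L * num_subseqs) \<and>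
     hash_buf m = [] \<and>
     (if phase m = Dist then rg m \<le> D \<and> length (dist_buf m) = rg m else dist_buf m = [])"

definition run_inv :: "memory \<Rightarrow> bool" where
  "run_inv m \<longleftrightarrow> series m = T \<and> length (queue m) \<le> k \<and>
     (case phase m of Draw \<Rightarrow> draw_inv m | Hash \<Rightarrow> hash_inv m | _ \<Rightarrow> search_inv m)"

section \<open>Preservation of the invariants\<close>

lemma index_less: "f * L + j < D * L" if "f < D" "j < L"
proof -
  have "f * L + j < Suc f * L"
    using that by simp
  also have "\<dots> \<le> D * L"
    using that by (intro mult_le_mono1) simp
  finally show ?thesis .
qed

lemma initial_run_inv: "run_inv initial"
  using dims pars
  by (simp add: run_inv_def draw_inv_def initial_def list_words_replicate)

lemma step_Draw:
  assumes "phase m = Draw" "run_inv m"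
  shows "run_inv (step \<omega> m)"
proof -
  have I: "series m = T" "length (queue m) \<le> k" "draw_inv m"
    using assms by (simp_all add: run_inv_def)
  show ?thesis
  proof (cases "rf m < D \<and> rj m < L \<and> rt m < K")
    case True
    let ?h = "(map (\<lambda>s. fst \<omega> (rf m, rj m, rt m, s)) [0..<w], snd \<omega> (rf m, rj m, rt m))"
    \<comment> \<open>The coefficient list takes \<open>w + 1\<close> words and the offset one
      more.\<close>
    have "hash_fun_words (hash_funs m @ [?h]) = hash_fun_words (hash_funs m) + (w + 2)"
      by (simp add: list_words_def sum_list_triv)
    then show ?thesis
      using True I assms(1)
      by (simp add: step_def run_inv_def draw_inv_def algebra_simps)
  next
    case False
    have "rf m \<le> D" "rj m \<le> L" "rt m \<le> K"
      using I by (simp_all add: draw_inv_def)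
    with False consider "rf m = D" | "rf m < D" "rj m = L" | "rf m < D" "rj m < L" "rt m = K"
      by linarith
    then show ?thesis
    proof cases
      case 1
      then show ?thesis
        using I assms(1) dims
        by (simp add: step_def run_inv_def draw_inv_def hash_inv_def algebra_simps)
    next
      \<comment> \<open>A carry: \<open>rf m * L + L = (rf m + 1) * L\<close>, so the count is
        unchanged.\<close>
      case 2
      then show ?thesis
        using I assms(1) pars
        by (simp add: step_def run_inv_def draw_inv_def add.commute)
    next
      case 3
      then show ?thesis
        using I assms(1)
        by (simp add: step_def run_inv_def draw_inv_def add.commute)
    qed
  qed
qed

lemma step_Hash:
  assumes "phase m = Hash" "run_inv m"
  shows "run_inv (step \<omega> m)"
proof -
  have I: "series m = T" "length (queue m) \<le> k" "hash_inv m"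
    using assms by (simp_all add: run_inv_def)
  show ?thesis
  proof (cases "rf m < D \<and> rj m < L \<and> ra m < num_subseqs \<and> rt m = K")
    case True
    let ?p = "rf m * L + rj m"
    let ?t = "insort_key fst (hash_buf m, ra m) (tables m ! ?p)"
    have "?p < length (tables m)"
      using True I by (simp add: hash_inv_def index_less)
    \<comment> \<open>The new table is the old one plus one entry, so the old words cancel in
      \<open>list_words_update\<close>. The buffer has length \<open>rt m = K\<close>, so the entry
      costs \<open>K + 1\<close> words for the string and one for the index.\<close>
    then have "tables_words ((tables m)[?p := ?t]) = tables_words (tables m) + (K + 2)"
      using list_words_update[of ?p "tables m" "list_words entry_words" ?t] True I
      by (simp add: hash_inv_def list_words_insort_key list_words_const)
    then show ?thesis
      using True I assms(1) pars
      by (simp add: step_def run_inv_def hash_inv_def table_def algebra_simps)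
  next
    case False
    have "rf m \<le> D" "rj m \<le> L" "ra m \<le> num_subseqs" "rt m \<le> K"
      using I by (simp_all add: hash_inv_def)
    with False consider "rf m = D" | "rf m < D" "rj m = L"
      | "rf m < D" "rj m < L" "ra m = num_subseqs"
      | "rf m < D" "rj m < L" "ra m < num_subseqs" "rt m < K"
      by linarith
    then show ?thesis
    proof cases
      case 1
      \<comment> \<open>\<open>rf m = D\<close> forces \<open>rt m = 0\<close>, which is the buffer
        length.\<close>
      moreover from this have "length (hash_buf m) = 0"
        using I by (simp add: hash_inv_def)
      ultimately show ?thesis
        using I assms(1)
        by (simp add: step_def run_inv_def hash_inv_def search_inv_def)
    next
      case 2
      then show ?thesis
        using I assms(1) pars
        by (simp add: step_def run_inv_def hash_inv_def num_subseqs_def add.commute)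
    next
      case 3
      then show ?thesis
        using I assms(1)
        by (simp add: step_def run_inv_def hash_inv_def num_subseqs_def add.commute)
    next
      case 4
      then show ?thesis
        using I assms(1)
        by (simp add: step_def run_inv_def hash_inv_def)
    qed
  qed
qed

text \<open>\<open>Dist\<close> is entered with \<open>rg = 0\<close> and an empty buffer, adds one
  distance per dimension and clears the buffer on leaving; an insertion cuts the queue to length
  \<open>k\<close>.\<close>

lemma step_search:
  assumes "phase m \<notin> {Draw, Hash}" "run_inv m"
  shows "run_inv (step \<omega> m)"
proof -
  have I: "series m = T" "length (queue m) \<le> k" "search_inv m"
    using assms by (auto simp: run_inv_def split: phase.splits)
  show ?thesis
    using I assms(1)
    by (cases "phase m")
      (simp_all add: step_def run_inv_def search_inv_def Let_def length_queue_insert)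
qed

lemma step_run_inv: "run_inv m \<Longrightarrow> run_inv (step \<omega> m)"
  using step_Draw step_Hash step_search by blast

lemma run_inv_reachable: "run_inv ((step \<omega> ^^ s) initial)"
  by (induction s) (simp_all add: initial_run_inv step_run_inv)

section \<open>From counters to a bound on the memory\<close>

text \<open>Without a pending carry the index is below \<open>D * L\<close>, which leaves room for
  one more block of size \<open>N\<close>; otherwise \<open>t = 0\<close>. It is used with
  \<open>N = K\<close> for drawing and \<open>N = num_subseqs\<close> for hashing.\<close>

lemma index_le:
  assumes "f \<le> D" "j \<le> L" "t \<le> N" "f = D \<longrightarrow> j = 0" "f = D \<or> j = L \<longrightarrow> t = 0"
  shows "(f * L + j) * N + t \<le> D * L * N"
proof (cases "f < D \<and> j < L")
  case True
  then have "Suc (f * L + j) * N \<le> D * L * N"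
    by (intro mult_le_mono1 Suc_leI index_less) simp_all
  then show ?thesis
    using assms by simp
next
  case False
  have "f * L + j \<le> D * L"
  proof (cases "f = D")
    case False
    then have "Suc f * L \<le> D * L"
      using assms by (intro mult_le_mono1) simp
    then show ?thesis
      using assms by simp
  qed (use assms in simp)
  then have "(f * L + j) * N \<le> D * L * N"
    by (rule mult_le_mono1)
  then show ?thesis
    using False assms by auto
qed

lemma run_inv_bounds:
  assumes "run_inv m"
  shows "hash_fun_words (hash_funs m) \<le> 1 + (w + 2) * (D * L * K)" (is ?hash_funs)
    and "tables_words (tables m) \<le> 1 + D * L + (K + 2) * (D * L * num_subseqs)" (is ?tables)
    and "length (hash_buf m) \<le> K" (is ?hash_buf)
    and "length (dist_buf m) \<le> D" (is ?dist_buf)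
proof -
  have "?hash_funs \<and> ?tables \<and> ?hash_buf \<and> ?dist_buf"
  proof (cases "phase m = Draw \<or> phase m = Hash")
    case True
    then consider "draw_inv m" | "hash_inv m"
      using assms by (auto simp: run_inv_def)
    then show ?thesis
    proof cases
      case 1
      then have "(rf m * L + rj m) * K + rt m \<le> D * L * K"
        by (intro index_le) (auto simp: draw_inv_def)
      then have "(w + 2) * ((rf m * L + rj m) * K + rt m) \<le> (w + 2) * (D * L * K)"
        by (rule mult_le_mono2)
      then show ?thesis
        using 1 by (simp add: draw_inv_def)
    next
      case 2
      then have "(rf m * L + rj m) * num_subseqs + ra m \<le> D * L * num_subseqs"
        by (intro index_le) (auto simp: hash_inv_def)
      then have "(K + 2) * ((rf m * L + rj m) * num_subseqs + ra m)
          \<le> (K + 2) * (D * L * num_subseqs)"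
        by (rule mult_le_mono2)
      then show ?thesis
        using 2 by (simp add: hash_inv_def)
    qed
  next
    case False
    then have "search_inv m"
      using assms by (cases "phase m") (simp_all add: run_inv_def)
    then show ?thesis
      by (simp add: search_inv_def split: if_splits)
  qed
  then show ?hash_funs ?tables ?hash_buf ?dist_buf
    by blast+
qed

lemma memory_words_bound:
  assumes "run_inv m" "k \<le> \<kappa> * (K * L * D * n)"
  shows "memory_words m \<le> (49 + 3 * \<kappa>) * (K * L * D * n)"
proof -
  let ?M = "K * L * D * n"
  have n: "1 \<le> n" and N: "num_subseqs \<le> n"
    using window by (simp_all add: num_subseqs_def)
  have le_mult: "x \<le> x * y" if "1 \<le> y" for x y :: nat
    using that by simp
  \<comment> \<open>The factors missing from the five products in \<open>small\<close>, in the same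
    order.\<close>
  have ge1: "1 \<le> L * D * n" "1 \<le> K * L * n" "1 \<le> K * L" "1 \<le> K * n" "1 \<le> n"
    using pars dims n by simp_all
  have small: "K \<le> ?M" "D \<le> ?M" "D * n \<le> ?M" "D * L \<le> ?M" "D * L * K \<le> ?M"
    using ge1[THEN le_mult, of K] ge1[THEN le_mult, of D] ge1[THEN le_mult, of "D * n"]
      ge1[THEN le_mult, of "D * L"] ge1[THEN le_mult, of "D * L * K"]
    by (simp_all only: ac_simps)
  have "1 \<le> ?M"
    using pars small(1) by linarith
  have "D * L * num_subseqs \<le> D * L * n"
    using N by (rule mult_le_mono2)
  also have "\<dots> \<le> D * L * n * K"
    using pars by (intro le_mult) simp
  finally have entries: "D * L * num_subseqs \<le> ?M"
    by (simp only: ac_simps)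
  \<comment> \<open>The two dominant terms: window length and number of subsequences are each at
    most \<open>n\<close>.\<close>
  have "w * (D * L * K) \<le> n * (D * L * K)" "K * (D * L * num_subseqs) \<le> K * (D * L * n)"
    using window(2) N by simp_all
  then have big: "w * (D * L * K) \<le> ?M" "K * (D * L * num_subseqs) \<le> ?M"
    by (simp_all only: ac_simps)
  have "series m = T" and queue: "length (queue m) \<le> k"
    using assms(1) by (simp_all add: run_inv_def)
  then have "list_words (list_words (\<lambda>_. 1)) (series m) = 1 + (1 + n) * D"
    using dims list_words_uniform[of T "list_words (\<lambda>_. 1)" "1 + n"]
    by (simp add: list_words_const)
  then have "list_words (list_words (\<lambda>_. 1)) (series m) = 1 + D + D * n"
    by (simp add: algebra_simps)
  moreover have "hash_fun_words (hash_funs m) \<le> 1 + w * (D * L * K) + 2 * (D * L * K)"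
    using run_inv_bounds(1)[OF assms(1)] by (simp add: add_mult_distrib)
  moreover have "tables_words (tables m)
      \<le> 1 + D * L + K * (D * L * num_subseqs) + 2 * (D * L * num_subseqs)"
    using run_inv_bounds(2)[OF assms(1)] by (simp add: add_mult_distrib)
  \<comment> \<open>Registers and six list headers give 32 + 6 = 38. Multiples of \<open>?M\<close>:
    series 2, hash functions 3, tables 4, buffers 1 each, together 11; and 38 + 11 = 49. The queue
    entries add \<open>3 * k\<close>.\<close>
  ultimately have "memory_words m \<le> 49 * ?M + 3 * (\<kappa> * ?M)"
    unfolding memory_words_def register_words_def list_words_const
    using run_inv_bounds(3,4)[OF assms(1)] queue assms(2) small entries big \<open>1 \<le> ?M\<close> by linarith
  then show ?thesis
    by (simp add: add_mult_distrib)
qed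

text \<open>The invariant holds after every step for each \<omega>, so the supremum is bounded
  surely, not just with high probability.\<close>

lemma run_space_bound:
  "k \<le> \<kappa> * (K * L * D * n) \<Longrightarrow> run_space \<omega> \<le> enat ((49 + 3 * \<kappa>) * (K * L * D * n))"
  unfolding run_space_def
  by (intro SUP_least) (simp only: enat_ord_simps memory_words_bound run_inv_reachable)

end

theorem theorem5p8:
  "\<forall>\<kappa>::nat. \<exists>C::nat. \<forall>n D w K L k d \<delta> r T stop.
     momenti n D w K L k d \<delta> r T \<and> k \<le> \<kappa> * (K * L * D * n) \<longrightarrow>
     (\<forall>\<omega>\<in>space (momenti.hash_measure D w K L r).
        momenti.run_space n D w K L k d \<delta> r T stop \<omega> \<le> enat (C * (K * L * D * n)))"
  \<comment> \<open>The witness \<open>49 + 3 * \<kappa>\<close> depends on \<kappa> alone.\<close>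
  by (meson momenti.run_space_bound)

end
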